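(* One has $\mu_2\le 0.784$. More generally, one has the upper estimates $$\mu_2\le 0.7675,\quad \mu_3\le 0.6588,\quad \mu_4\le 0.5872,\quad \mu_5\le 0.5352,\quad \mu_6\le 0.4953,$$ $$\mu_7\le 0.4633,\quad \mu_8\le 0.4369,\quad \mu_9\le 0.4147,\quad \mu_{10}\le 0.3956.$$
   Context: For $g\ge 2$ let $\Gamma_g$ be the fundamental group of the closed orientable surface of genus $g$, given by the presentation $\Gamma_g=\langle a_1,b_1,\dots,a_g,b_g \mid \prod_{j=1}^g a_jb_ja_j^{-1}b_j^{-1}=1\rangle$, and let $S_g=\{a_1,a_1^{-1},b_1,b_1^{-1},\dots,a_g,a_g^{-1},b_g,b_g^{-1}\}$, a symmetric generating set with $4g$ elements. The Cayley graph $X_g=\mathrm{Cay}(\Gamma_g,S_g)$ has vertex set $\Gamma_g$, with $\{x,y\}$ an edge if and only if $x^{-1}y\in S_g$; it is $4g$-regular. The Markov operator $M$ of a connected $k$-regular graph with vertex set $X^0$ is $(Mf)(x)=\frac1k\sum_{y\sim x}f(y)$ (sum over neighbours $y$ of $x$), a bounded self-adjoint operator on $\ell^2(X^0)$; the spectral radius of the graph is the operator norm of $M$ on $\ell^2(X^0)$. The number $\mu_g$ is the spectral radius of $X_g$. *)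

theory Defs
  imports "HOL-Analysis.Analysis" "HOL-Algebra.Group"
begin

section \<open>Groups given by a presentation\<close>

text \<open>Two words over \<open>X\<close> are identified if they represent the same element of \<open>\<langle>X | R\<rangle>\<close>, that is,
  if they are related by the congruence generated by free cancellation and the relators.
  A letter \<open>(x, True)\<close> stands for the generator \<open>x\<close> and \<open>(x, False)\<close> for its formal inverse.\<close>

type_synonym 'a gword = "('a \<times> bool) list"

definition gwords :: "'a set \<Rightarrow> 'a gword set" where
  "gwords X = lists (X \<times> UNIV)"

inductive_set pres_rel :: "'a set \<Rightarrow> 'a gword set \<Rightarrow> ('a gword \<times> 'a gword) set"
  for X :: "'a set" and R :: "'a gword set" where
  pres_refl: "w \<in> gwords X \<Longrightarrow> (w, w) \<in> pres_rel X R"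
| pres_sym: "(v, w) \<in> pres_rel X R \<Longrightarrow> (w, v) \<in> pres_rel X R"
| pres_trans: "(u, v) \<in> pres_rel X R \<Longrightarrow> (v, w) \<in> pres_rel X R \<Longrightarrow> (u, w) \<in> pres_rel X R"
| pres_cancel: "u \<in> gwords X \<Longrightarrow> v \<in> gwords X \<Longrightarrow> x \<in> X \<Longrightarrow>
    (u @ [(x, b), (x, \<not> b)] @ v, u @ v) \<in> pres_rel X R"
| pres_relator: "u \<in> gwords X \<Longrightarrow> v \<in> gwords X \<Longrightarrow> r \<in> R \<Longrightarrow> r \<in> gwords X \<Longrightarrow>
    (u @ r @ v, u @ v) \<in> pres_rel X R"

definition presented_group :: "'a set \<Rightarrow> 'a gword set \<Rightarrow> 'a gword set monoid" where
  "presented_group X R =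
    \<lparr>carrier = gwords X // pres_rel X R,
     mult = (\<lambda>A B. \<Union>a\<in>A. \<Union>b\<in>B. pres_rel X R `` {a @ b}),
     one = pres_rel X R `` {[]}\<rparr>"

definition pres_gen :: "'a set \<Rightarrow> 'a gword set \<Rightarrow> 'a \<Rightarrow> 'a gword set" where
  "pres_gen X R x = pres_rel X R `` {[(x, True)]}"

section \<open>Surface groups\<close>

datatype surface_gen = GenA nat | GenB nat

definition surface_gens :: "nat \<Rightarrow> surface_gen set" where
  "surface_gens g = GenA ` {1..g} \<union> GenB ` {1..g}"

definition surface_relator :: "nat \<Rightarrow> surface_gen gword" where
  "surface_relator g =
    concat (map (\<lambda>j. [(GenA j, True), (GenB j, True), (GenA j, False), (GenB j, False)]) [1..<Suc g])"

definition surface_group :: "nat \<Rightarrow> surface_gen gword set monoid" where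
  "surface_group g = presented_group (surface_gens g) {surface_relator g}"

definition surface_sym_gens :: "nat \<Rightarrow> surface_gen gword set set" where
  "surface_sym_gens g =
    (\<Union>x\<in>surface_gens g.
      let s = pres_gen (surface_gens g) {surface_relator g} x in {s, inv\<^bsub>surface_group g\<^esub> s})"

section \<open>Graphs, Markov operators, spectral radius\<close>

record 'v ugraph =
  verts :: "'v set"
  edges :: "'v set set"

definition cayley_graph :: "('v, 'b) monoid_scheme \<Rightarrow> 'v set \<Rightarrow> 'v ugraph" where
  "cayley_graph G S =
    \<lparr>verts = carrier G,
     edges = {{x, y} | x y. x \<in> carrier G \<and> y \<in> carrier G \<and> inv\<^bsub>G\<^esub> x \<otimes>\<^bsub>G\<^esub> y \<in> S}\<rparr>"

definition neighbors :: "'v ugraph \<Rightarrow> 'v \<Rightarrow> 'v set" where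
  "neighbors G x = {y \<in> verts G. {x, y} \<in> edges G}"

definition regular_ugraph :: "nat \<Rightarrow> 'v ugraph \<Rightarrow> bool" where
  "regular_ugraph k G \<longleftrightarrow> (\<forall>x\<in>verts G. finite (neighbors G x) \<and> card (neighbors G x) = k)"

text \<open>On a \<open>k\<close>-regular graph the factor below is \<open>1 / k\<close>; \<open>surface_cayley_graph_regular\<close> shows
  that the graphs considered here are \<open>4g\<close>-regular.\<close>

definition markov_operator :: "'v ugraph \<Rightarrow> ('v \<Rightarrow> complex) \<Rightarrow> 'v \<Rightarrow> complex" where
  "markov_operator G f x =
    1 / of_nat (card (neighbors G x)) * (\<Sum>y\<in>neighbors G x. f y)"

definition ell2 :: "'v set \<Rightarrow> ('v \<Rightarrow> complex) set" where
  "ell2 V = {f. (\<lambda>x. (cmod (f x))\<^sup>2) summable_on V}"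

definition ell2_norm :: "'v set \<Rightarrow> ('v \<Rightarrow> complex) \<Rightarrow> real" where
  "ell2_norm V f = sqrt (\<Sum>\<^sub>\<infinity>x\<in>V. (cmod (f x))\<^sup>2)"

text \<open>The analogue of \<^const>\<open>onorm\<close> for operators on \<open>\<ell>\<^sup>2(V)\<close>. As with \<^const>\<open>onorm\<close>, it is
  meaningful for bounded operators only; see \<open>markov_operator_bounded\<close>.\<close>

definition ell2_onorm :: "'v set \<Rightarrow> (('v \<Rightarrow> complex) \<Rightarrow> ('v \<Rightarrow> complex)) \<Rightarrow> real" where
  "ell2_onorm V T = (SUP f\<in>ell2 V. ell2_norm V (T f) / ell2_norm V f)"

definition spectral_radius :: "'v ugraph \<Rightarrow> real" where
  "spectral_radius G = ell2_onorm (verts G) (markov_operator G)"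

definition surface_cayley_graph :: "nat \<Rightarrow> surface_gen gword set ugraph" where
  "surface_cayley_graph g = cayley_graph (surface_group g) (surface_sym_gens g)"

definition mu :: "nat \<Rightarrow> real" where
  "mu g = spectral_radius (surface_cayley_graph g)"

section \<open>Basic facts\<close>

lemma pres_rel_gwords: "(u, v) \<in> pres_rel X R \<Longrightarrow> u \<in> gwords X \<and> v \<in> gwords X"
  by (induction rule: pres_rel.induct) (auto simp: gwords_def)

lemma equiv_pres_rel: "equiv (gwords X) (pres_rel X R)"
proof (rule equivI)
  show "pres_rel X R \<subseteq> gwords X \<times> gwords X"
    by (auto dest: pres_rel_gwords)
  show "refl_on (gwords X) (pres_rel X R)"
    by (auto simp: refl_on_def intro: pres_refl)
  show "sym (pres_rel X R)"
    by (rule symI) (rule pres_sym)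
  show "trans (pres_rel X R)"
    by (rule transI) (rule pres_trans)
qed

lemma gwords_append [simp]: "u @ v \<in> gwords X \<longleftrightarrow> u \<in> gwords X \<and> v \<in> gwords X"
  by (auto simp: gwords_def)

lemma gwords_Nil [simp]: "[] \<in> gwords X"
  by (auto simp: gwords_def)

lemma gwords_Cons [simp]: "a # w \<in> gwords X \<longleftrightarrow> fst a \<in> X \<and> w \<in> gwords X"
  by (cases a) (auto simp: gwords_def)

lemma pres_rel_context:
  "(u, v) \<in> pres_rel X R \<Longrightarrow> p \<in> gwords X \<Longrightarrow> q \<in> gwords X \<Longrightarrow> (p @ u @ q, p @ v @ q) \<in> pres_rel X R"
proof (induction rule: pres_rel.induct)
  case (pres_refl w)
  then show ?case by (auto intro: pres_rel.pres_refl)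
next
  case (pres_sym v w)
  then show ?case by (simp add: pres_rel.pres_sym)
next
  case (pres_trans u v w)
  then show ?case by (blast intro: pres_rel.pres_trans)
next
  case (pres_cancel u v x b)
  then show ?case using pres_rel.pres_cancel[of "p @ u" X "v @ q" x b R] by simp
next
  case (pres_relator u v r)
  then show ?case using pres_rel.pres_relator[of "p @ u" X "v @ q" r R] by simp
qed

lemma pres_rel_append:
  assumes "(u, u') \<in> pres_rel X R" "(v, v') \<in> pres_rel X R"
  shows "(u @ v, u' @ v') \<in> pres_rel X R"
proof -
  have "([] @ u @ v, [] @ u' @ v) \<in> pres_rel X R"
    by (rule pres_rel_context) (use assms pres_rel_gwords in auto)
  moreover have "(u' @ v @ [], u' @ v' @ []) \<in> pres_rel X R"
    by (rule pres_rel_context) (use assms pres_rel_gwords in auto)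
  ultimately show ?thesis using pres_trans[of "u @ v" "u' @ v" X R "u' @ v'"] by simp
qed

lemma pres_class_eq_iff:
  assumes "u \<in> gwords X" "v \<in> gwords X"
  shows "pres_rel X R `` {u} = pres_rel X R `` {v} \<longleftrightarrow> (u, v) \<in> pres_rel X R"
  using eq_equiv_class_iff[OF equiv_pres_rel assms] .

lemma presented_group_mult:
  assumes "u \<in> gwords X" "v \<in> gwords X"
  shows "pres_rel X R `` {u} \<otimes>\<^bsub>presented_group X R\<^esub> pres_rel X R `` {v} = pres_rel X R `` {u @ v}"
proof -
  let ?P = "pres_rel X R"
  have eq: "?P `` {a @ b} = ?P `` {u @ v}" if "a \<in> ?P `` {u}" "b \<in> ?P `` {v}" for a b
    by (rule equiv_class_eq[OF equiv_pres_rel, symmetric], rule pres_rel_append) (use that in auto)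
  have "(\<Union>a\<in>?P `` {u}. \<Union>b\<in>?P `` {v}. ?P `` {a @ b}) = (\<Union>a\<in>?P `` {u}. \<Union>b\<in>?P `` {v}. ?P `` {u @ v})"
    by (rule SUP_cong[OF refl SUP_cong[OF refl eq]])
  also have "\<dots> = ?P `` {u @ v}"
    using pres_refl[OF assms(1), of R] pres_refl[OF assms(2), of R] by blast
  finally show ?thesis
    by (simp add: presented_group_def)
qed

lemma presented_group_one: "\<one>\<^bsub>presented_group X R\<^esub> = pres_rel X R `` {[]}"
  by (simp add: presented_group_def)

lemma presented_group_carrierI:
  "u \<in> gwords X \<Longrightarrow> pres_rel X R `` {u} \<in> carrier (presented_group X R)"
  by (simp add: presented_group_def quotientI)

lemma presented_group_carrierE:
  assumes "A \<in> carrier (presented_group X R)"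
  obtains u where "u \<in> gwords X" "A = pres_rel X R `` {u}"
  using assms by (auto simp: presented_group_def elim: quotientE)

definition gword_inv :: "'a gword \<Rightarrow> 'a gword" where
  "gword_inv w = rev (map (\<lambda>(x, b). (x, \<not> b)) w)"

lemma gword_inv_in [simp]: "gword_inv w \<in> gwords X \<longleftrightarrow> w \<in> gwords X"
  by (induction w) (auto simp: gword_inv_def)

lemma gword_inv_left: "w \<in> gwords X \<Longrightarrow> (gword_inv w @ w, []) \<in> pres_rel X R"
proof (induction w)
  case Nil
  then show ?case by (simp add: gword_inv_def pres_refl)
next
  case (Cons a w)
  obtain x b where a: "a = (x, b)" by (cases a)
  have "(gword_inv w @ [(x, \<not> b), (x, \<not> \<not> b)] @ w, gword_inv w @ w) \<in> pres_rel X R"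
    by (rule pres_cancel) (use Cons.prems a in auto)
  then have "(gword_inv (a # w) @ a # w, gword_inv w @ w) \<in> pres_rel X R"
    by (simp add: gword_inv_def a)
  moreover have "(gword_inv w @ w, []) \<in> pres_rel X R" using Cons by auto
  ultimately show ?case by (rule pres_trans)
qed

lemma presented_group_group: "group (presented_group X R)"
proof (rule groupI)
  fix A B assume "A \<in> carrier (presented_group X R)" "B \<in> carrier (presented_group X R)"
  then show "A \<otimes>\<^bsub>presented_group X R\<^esub> B \<in> carrier (presented_group X R)"
    by (elim presented_group_carrierE) (simp add: presented_group_mult presented_group_carrierI)
next
  show "\<one>\<^bsub>presented_group X R\<^esub> \<in> carrier (presented_group X R)"
    by (simp add: presented_group_one presented_group_carrierI)
next
  fix A B C
  assume "A \<in> carrier (presented_group X R)" "B \<in> carrier (presented_group X R)"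
    "C \<in> carrier (presented_group X R)"
  then show "A \<otimes>\<^bsub>presented_group X R\<^esub> B \<otimes>\<^bsub>presented_group X R\<^esub> C =
    A \<otimes>\<^bsub>presented_group X R\<^esub> (B \<otimes>\<^bsub>presented_group X R\<^esub> C)"
    by (elim presented_group_carrierE) (simp add: presented_group_mult)
next
  fix A assume A: "A \<in> carrier (presented_group X R)"
  then show "\<one>\<^bsub>presented_group X R\<^esub> \<otimes>\<^bsub>presented_group X R\<^esub> A = A"
    by (elim presented_group_carrierE) (simp add: presented_group_one presented_group_mult)
  obtain u where u: "u \<in> gwords X" "A = pres_rel X R `` {u}"
    using A by (rule presented_group_carrierE)
  have "pres_rel X R `` {gword_inv u} \<otimes>\<^bsub>presented_group X R\<^esub> A = \<one>\<^bsub>presented_group X R\<^esub>"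
    using u gword_inv_left[OF u(1), of R]
    by (simp add: presented_group_mult presented_group_one pres_class_eq_iff)
  then show "\<exists>B\<in>carrier (presented_group X R). B \<otimes>\<^bsub>presented_group X R\<^esub> A = \<one>\<^bsub>presented_group X R\<^esub>"
    by (rule bexI) (rule presented_group_carrierI, simp add: u(1))
qed

lemma presented_group_inv:
  assumes "u \<in> gwords X"
  shows "inv\<^bsub>presented_group X R\<^esub> (pres_rel X R `` {u}) = pres_rel X R `` {gword_inv u}"
proof -
  interpret group "presented_group X R" by (rule presented_group_group)
  show ?thesis
  proof (rule inv_equality)
    show "pres_rel X R `` {gword_inv u} \<otimes>\<^bsub>presented_group X R\<^esub> pres_rel X R `` {u} =
        \<one>\<^bsub>presented_group X R\<^esub>"
      using assms gword_inv_left[OF assms, of R]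
      by (simp add: presented_group_mult presented_group_one pres_class_eq_iff)
    show "pres_rel X R `` {u} \<in> carrier (presented_group X R)"
      using assms by (rule presented_group_carrierI)
    show "pres_rel X R `` {gword_inv u} \<in> carrier (presented_group X R)"
      by (rule presented_group_carrierI) (use assms in simp)
  qed
qed

fun gword_eval :: "('h, 'b) monoid_scheme \<Rightarrow> ('a \<Rightarrow> 'h) \<Rightarrow> 'a gword \<Rightarrow> 'h" where
  "gword_eval H f [] = \<one>\<^bsub>H\<^esub>"
| "gword_eval H f ((x, b) # w) = (if b then f x else inv\<^bsub>H\<^esub> (f x)) \<otimes>\<^bsub>H\<^esub> gword_eval H f w"

context
  fixes H :: "('h, 'b) monoid_scheme" and f :: "'a \<Rightarrow> 'h" and X :: "'a set" and R :: "'a gword set"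
  assumes H: "group H" and f: "f \<in> X \<rightarrow> carrier H"
begin

interpretation group H by (rule H)

lemma gword_eval_closed: "w \<in> gwords X \<Longrightarrow> gword_eval H f w \<in> carrier H"
proof (induction w)
  case (Cons a w)
  obtain x b where a: "a = (x, b)" by (cases a)
  have "f x \<in> carrier H" using Cons.prems a f by auto
  then show ?case using Cons a by simp
qed simp

lemma gword_eval_append:
  "u \<in> gwords X \<Longrightarrow> v \<in> gwords X \<Longrightarrow> gword_eval H f (u @ v) = gword_eval H f u \<otimes>\<^bsub>H\<^esub> gword_eval H f v"
proof (induction u)
  case (Cons a u)
  obtain x b where a: "a = (x, b)" by (cases a)
  have "f x \<in> carrier H" using Cons.prems a f by auto
  moreover have "gword_eval H f u \<in> carrier H" "gword_eval H f v \<in> carrier H"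
    using Cons.prems by (simp_all add: gword_eval_closed)
  ultimately show ?case using Cons a by (simp add: m_assoc)
qed (simp add: gword_eval_closed)

lemma gword_eval_pres_rel:
  assumes R: "\<And>r. r \<in> R \<Longrightarrow> gword_eval H f r = \<one>\<^bsub>H\<^esub>"
  shows "(u, v) \<in> pres_rel X R \<Longrightarrow> gword_eval H f u = gword_eval H f v"
proof (induction rule: pres_rel.induct)
  case (pres_cancel u v x b)
  then have x: "f x \<in> carrier H" using f by auto
  have "gword_eval H f ([(x, b), (x, \<not> b)] @ v) = gword_eval H f v"
    using x gword_eval_closed[OF pres_cancel(2)] by (cases b) (simp_all add: m_assoc[symmetric])
  moreover have "[(x, b), (x, \<not> b)] @ v \<in> gwords X" using pres_cancel by simp
  ultimately show ?case
    using pres_cancel gword_eval_append[of u "[(x, b), (x, \<not> b)] @ v"] gword_eval_append[of u v]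
    by (simp only:)
next
  case (pres_relator u v r)
  then show ?case by (simp add: gword_eval_append gword_eval_closed R)
qed auto

lemma presented_group_hom_exists:
  assumes R: "\<And>r. r \<in> R \<Longrightarrow> gword_eval H f r = \<one>\<^bsub>H\<^esub>"
  obtains h where "h \<in> hom (presented_group X R) H" "\<And>x. x \<in> X \<Longrightarrow> h (pres_gen X R x) = f x"
proof -
  define h where "h A = gword_eval H f (SOME u. u \<in> A)" for A :: "'a gword set"
  have h: "h (pres_rel X R `` {u}) = gword_eval H f u" if "u \<in> gwords X" for u
  proof -
    have "u \<in> pres_rel X R `` {u}" using that by (auto intro: pres_refl)
    then have "(SOME v. v \<in> pres_rel X R `` {u}) \<in> pres_rel X R `` {u}" by (rule someI)
    then show ?thesis unfolding h_def using gword_eval_pres_rel[OF R] by force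
  qed
  show thesis
  proof
    show "h \<in> hom (presented_group X R) H"
      by (rule homI; elim presented_group_carrierE)
        (simp_all add: h presented_group_mult gword_eval_append gword_eval_closed)
    show "h (pres_gen X R x) = f x" if "x \<in> X" for x
      proof -
      have "f x \<in> carrier H" using that f by auto
      then show ?thesis using that by (simp add: pres_gen_def h)
    qed
  qed
qed

end

lemma pres_gen_carrier: "x \<in> X \<Longrightarrow> pres_gen X R x \<in> carrier (presented_group X R)"
  by (auto simp: pres_gen_def intro: presented_group_carrierI)

lemma gword_eval_pres_gen:
  "w \<in> gwords X \<Longrightarrow> gword_eval (presented_group X R) (pres_gen X R) w = pres_rel X R `` {w}"
proof (induction w)
  case Nil
  then show ?case by (simp add: presented_group_one)
next
  case (Cons a w)
  then show ?case
    by (cases a) (auto simp: pres_gen_def presented_group_inv presented_group_mult gword_inv_def)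
qed

lemma surface_group_group: "group (surface_group g)"
  unfolding surface_group_def by (rule presented_group_group)

lemma surface_relator_gwords: "surface_relator g \<in> gwords (surface_gens g)"
proof -
  have "concat (map (\<lambda>j. [(GenA j, True), (GenB j, True), (GenA j, False), (GenB j, False)]) js)
      \<in> gwords (surface_gens g)" if "set js \<subseteq> {1..g}" for js
    using that by (induction js) (auto simp: surface_gens_def)
  then show ?thesis by (simp add: surface_relator_def atLeastLessThanSuc_atLeastAtMost del: upt_Suc)
qed

lemma surface_sym_gens_carrier: "surface_sym_gens g \<subseteq> carrier (surface_group g)"
proof -
  interpret group "surface_group g" by (rule surface_group_group)
  have "pres_gen (surface_gens g) {surface_relator g} x \<in> carrier (surface_group g)"
    if "x \<in> surface_gens g" for x
    using that by (simp add: surface_group_def pres_gen_carrier)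
  then show ?thesis by (auto simp: surface_sym_gens_def Let_def)
qed

text \<open>Exponent sums are well defined on the surface group; they separate the elements of the
  symmetric generating set.\<close>

lemma surface_exponent_sum:
  fixes c :: "surface_gen \<Rightarrow> int"
  obtains h where
    "\<And>x. x \<in> surface_gens g \<Longrightarrow> h (pres_gen (surface_gens g) {surface_relator g} x) = c x"
    "\<And>x. x \<in> surface_gens g \<Longrightarrow>
      h (inv\<^bsub>surface_group g\<^esub> (pres_gen (surface_gens g) {surface_relator g} x)) = - c x"
    "h \<one>\<^bsub>surface_group g\<^esub> = 0"
proof -
  let ?Z = "\<lparr>carrier = (UNIV :: int set), mult = (+), one = 0\<rparr>"
  have Z: "group ?Z"
  proof (rule groupI)
    show "\<exists>y\<in>carrier ?Z. y \<otimes>\<^bsub>?Z\<^esub> x = \<one>\<^bsub>?Z\<^esub>" for x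
      by (rule bexI[of _ "- x"]) simp_all
  qed simp_all
  interpret Z: group ?Z by (rule Z)
  have invZ: "inv\<^bsub>?Z\<^esub> a = - a" for a :: int
    by (rule Z.inv_equality) auto
  have ev: "gword_eval ?Z c (concat (map (\<lambda>j. [(GenA j, True), (GenB j, True), (GenA j, False), (GenB j, False)]) js)) = 0"
    for js by (induction js) (auto simp: invZ)
  obtain h where h: "h \<in> hom (surface_group g) ?Z"
    "\<And>x. x \<in> surface_gens g \<Longrightarrow> h (pres_gen (surface_gens g) {surface_relator g} x) = c x"
    using presented_group_hom_exists[OF Z, of c "surface_gens g" "{surface_relator g}"] ev
    by (auto simp: surface_relator_def surface_group_def)
  interpret gh: group_hom "surface_group g" ?Z h
    using h Z surface_group_group by (auto simp: group_hom_def group_hom_axioms_def)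
  show thesis
  proof
    fix x assume x: "x \<in> surface_gens g"
    then have "pres_gen (surface_gens g) {surface_relator g} x \<in> carrier (surface_group g)"
      by (simp add: surface_group_def pres_gen_carrier)
    then show "h (inv\<^bsub>surface_group g\<^esub> (pres_gen (surface_gens g) {surface_relator g} x)) = - c x"
      using x h invZ by simp
  qed (use h gh.hom_one in auto)
qed

lemma surface_sym_gens_card: "finite (surface_sym_gens g) \<and> card (surface_sym_gens g) = 4 * g"
proof -
  define s where "s = pres_gen (surface_gens g) {surface_relator g}"
  define e where "e = (\<lambda>(x, b). if b then s x else inv\<^bsub>surface_group g\<^esub> (s x))"
  have S: "surface_sym_gens g = e ` (surface_gens g \<times> UNIV)"
  proof -
    have "(\<lambda>b. e (x, b)) ` UNIV = {s x, inv\<^bsub>surface_group g\<^esub> (s x)}" for x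
      unfolding UNIV_bool by (auto simp: e_def)
    moreover have "e ` (surface_gens g \<times> UNIV) = (\<Union>x\<in>surface_gens g. (\<lambda>b. e (x, b)) ` UNIV)"
      by auto
    ultimately show ?thesis by (simp only: surface_sym_gens_def Let_def s_def)
  qed
  have "inj_on e (surface_gens g \<times> UNIV)"
  proof (rule inj_onI, clarify)
    fix x b y b' assume x: "x \<in> surface_gens g" and y: "y \<in> surface_gens g" and eq: "e (x, b) = e (y, b')"
    obtain h where h: "\<And>z. z \<in> surface_gens g \<Longrightarrow> h (s z) = (if z = x then 1 else (0 :: int))"
      "\<And>z. z \<in> surface_gens g \<Longrightarrow> h (inv\<^bsub>surface_group g\<^esub> (s z)) = - (if z = x then 1 else (0 :: int))"
      using surface_exponent_sum[of g "\<lambda>z. if z = x then 1 else 0"] unfolding s_def by metis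
    have he: "h (e (x, b)) = (if b then 1 else -1)"
      using x by (simp add: e_def h)
    have he': "h (e (y, b')) = (if y = x then if b' then 1 else -1 else 0)"
      using h(1)[OF y] h(2)[OF y] by (cases "y = x"; cases b') (simp_all add: e_def)
    have "(if b then 1 else -1) = (if y = x then if b' then 1 else -1 else (0 :: int))"
      by (rule trans[OF he[symmetric] trans[OF arg_cong[OF eq, of h] he']])
    then show "x = y \<and> b = b'" by (auto split: if_splits)
  qed
  moreover have "finite (surface_gens g)" by (simp add: surface_gens_def)
  moreover have "card (surface_gens g) = 2 * g"
    unfolding surface_gens_def by (subst card_Un_disjoint) (auto simp: card_image inj_on_def)
  ultimately show ?thesis
    by (simp add: S card_image card_cartesian_product)
qed

lemma surface_sym_gens_inv:
  "s \<in> surface_sym_gens g \<Longrightarrow> inv\<^bsub>surface_group g\<^esub> s \<in> surface_sym_gens g"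
proof -
  interpret group "surface_group g" by (rule surface_group_group)
  have "pres_gen (surface_gens g) {surface_relator g} x \<in> carrier (surface_group g)"
    if "x \<in> surface_gens g" for x
    using that by (simp add: surface_group_def pres_gen_carrier)
  then show "s \<in> surface_sym_gens g \<Longrightarrow> inv\<^bsub>surface_group g\<^esub> s \<in> surface_sym_gens g"
    by (auto simp: surface_sym_gens_def Let_def)
qed

lemma surface_sym_gens_not_one: "\<one>\<^bsub>surface_group g\<^esub> \<notin> surface_sym_gens g"
proof
  assume "\<one>\<^bsub>surface_group g\<^esub> \<in> surface_sym_gens g"
  moreover obtain h where "h \<one>\<^bsub>surface_group g\<^esub> = (0 :: int)"
    "\<And>x. x \<in> surface_gens g \<Longrightarrow> h (pres_gen (surface_gens g) {surface_relator g} x) = 1"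
    "\<And>x. x \<in> surface_gens g \<Longrightarrow>
      h (inv\<^bsub>surface_group g\<^esub> (pres_gen (surface_gens g) {surface_relator g} x)) = - 1"
    using surface_exponent_sum[of g "\<lambda>_. 1"] by metis
  ultimately show False by (auto simp: surface_sym_gens_def Let_def)
qed

lemma surface_neighbors:
  assumes x: "x \<in> carrier (surface_group g)"
  shows "neighbors (surface_cayley_graph g) x = (\<lambda>s. x \<otimes>\<^bsub>surface_group g\<^esub> s) ` surface_sym_gens g"
proof -
  let ?G = "surface_group g"
  interpret group ?G by (rule surface_group_group)
  have swap: "inv\<^bsub>?G\<^esub> v \<otimes>\<^bsub>?G\<^esub> u \<in> surface_sym_gens g"
    if "u \<in> carrier ?G" "v \<in> carrier ?G" "inv\<^bsub>?G\<^esub> u \<otimes>\<^bsub>?G\<^esub> v \<in> surface_sym_gens g" for u v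
    using surface_sym_gens_inv[OF that(3)] that by (simp add: inv_mult_group)
  have "neighbors (surface_cayley_graph g) x =
    {y \<in> carrier ?G. inv\<^bsub>?G\<^esub> x \<otimes>\<^bsub>?G\<^esub> y \<in> surface_sym_gens g}"
    using x swap by (auto simp: neighbors_def surface_cayley_graph_def cayley_graph_def doubleton_eq_iff)
  also have "\<dots> = (\<lambda>s. x \<otimes>\<^bsub>?G\<^esub> s) ` surface_sym_gens g"
  proof safe
    fix y assume y: "y \<in> carrier ?G" "inv\<^bsub>?G\<^esub> x \<otimes>\<^bsub>?G\<^esub> y \<in> surface_sym_gens g"
    have "y = x \<otimes>\<^bsub>?G\<^esub> (inv\<^bsub>?G\<^esub> x \<otimes>\<^bsub>?G\<^esub> y)"
      using x y by (simp add: m_assoc[symmetric])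
    then show "y \<in> (\<lambda>s. x \<otimes>\<^bsub>?G\<^esub> s) ` surface_sym_gens g" using y by blast
  next
    fix s assume "s \<in> surface_sym_gens g"
    moreover from this have "s \<in> carrier ?G" using surface_sym_gens_carrier by blast
    ultimately show "x \<otimes>\<^bsub>?G\<^esub> s \<in> carrier ?G"
      "inv\<^bsub>?G\<^esub> x \<otimes>\<^bsub>?G\<^esub> (x \<otimes>\<^bsub>?G\<^esub> s) \<in> surface_sym_gens g"
      using x by (simp_all add: m_assoc[symmetric])
  qed
  finally show ?thesis .
qed

lemma surface_cayley_graph_regular: "regular_ugraph (4 * g) (surface_cayley_graph g)"
proof -
  interpret group "surface_group g" by (rule surface_group_group)
  have "card ((\<lambda>s. x \<otimes>\<^bsub>surface_group g\<^esub> s) ` surface_sym_gens g) = card (surface_sym_gens g)"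
    if "x \<in> carrier (surface_group g)" for x
    by (rule card_image) (use that surface_sym_gens_carrier in \<open>auto simp: inj_on_def subset_iff\<close>)
  moreover have "verts (surface_cayley_graph g) = carrier (surface_group g)"
    by (simp add: surface_cayley_graph_def cayley_graph_def)
  ultimately show ?thesis
    using surface_sym_gens_card[of g] by (simp add: regular_ugraph_def surface_neighbors)
qed

text \<open>The Markov operator of a regular graph is a contraction of \<open>\<ell>\<^sup>2\<close>; in particular the supremum
  defining the spectral radius is taken over a bounded set.\<close>

lemma markov_operator_bounded:
  assumes reg: "regular_ugraph k G" and f: "f \<in> ell2 (verts G)"
  shows "markov_operator G f \<in> ell2 (verts G)"
    and "ell2_norm (verts G) (markov_operator G f) \<le> ell2_norm (verts G) f"
proof -
  let ?V = "verts G" and ?N = "neighbors G" and ?q = "\<lambda>x. (cmod (f x))\<^sup>2"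
  let ?m = "\<lambda>x. (cmod (markov_operator G f x))\<^sup>2"
  have fin: "finite (?N x)" and card: "card (?N x) = k" if "x \<in> ?V" for x
    using reg that by (auto simp: regular_ugraph_def)
  have le: "?m x \<le> 1 / real k * (\<Sum>y\<in>?N x. ?q y)" if x: "x \<in> ?V" for x
  proof (cases "k = 0")
    case True
    then show ?thesis using card[OF x] by (simp add: markov_operator_def)
  next
    case False
    have "cmod (\<Sum>y\<in>?N x. f y) \<le> (\<Sum>y\<in>?N x. cmod (f y))" by (rule norm_sum)
    then have "(cmod (\<Sum>y\<in>?N x. f y))\<^sup>2 \<le> (\<Sum>y\<in>?N x. cmod (f y))\<^sup>2" by (rule power_mono) simp
    also have "\<dots> \<le> real k * (\<Sum>y\<in>?N x. ?q y)"
      using Cauchy_Schwarz_ineq_sum[of "\<lambda>_. 1" "\<lambda>y. cmod (f y)" "?N x"] card[OF x] by simp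
    finally show ?thesis
      using False card[OF x]
      by (simp add: markov_operator_def norm_mult norm_divide power_mult_distrib power_divide
          divide_simps power2_eq_square mult_ac)
  qed
  have qs: "(?q has_sum infsum ?q ?V) ?V"
    using f by (auto simp: ell2_def)
  have "((\<lambda>(y, x). ?q y) has_sum (real k * infsum ?q ?V)) (SIGMA y:?V. ?N y)"
  proof (rule has_sum_SigmaI)
    show "((\<lambda>x. case (y, x) of (y, x) \<Rightarrow> ?q y) has_sum real k * ?q y) (?N y)" if "y \<in> ?V" for y
      using has_sum_finite[OF fin[OF that], of "\<lambda>_. ?q y"] card[OF that] by simp
    show "((\<lambda>y. real k * ?q y) has_sum real k * infsum ?q ?V) ?V"
      using qs by (rule has_sum_cmult_right)
    have "(\<lambda>y. real k * ?q y) summable_on ?V"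
      using has_sum_cmult_right[OF qs] by (rule has_sum_imp_summable)
    then show "(\<lambda>(y, x). ?q y) summable_on (SIGMA y:?V. ?N y)"
      by (intro summable_on_SigmaI[where g = "\<lambda>y. real k * ?q y"])
        (use fin card has_sum_finite[of _ "\<lambda>_. ?q _"] in \<open>auto intro!: has_sum_finiteI\<close>)
  qed
  then have "((\<lambda>(x, y). ?q y) has_sum (real k * infsum ?q ?V)) (SIGMA x:?V. ?N x)"
    by (rule has_sum_reindex_bij_witness[of _ prod.swap prod.swap, THEN iffD1, rotated -1])
      (auto simp: neighbors_def insert_commute)
  then have "((\<lambda>x. \<Sum>y\<in>?N x. ?q y) has_sum (real k * infsum ?q ?V)) ?V"
    by (rule has_sum_SigmaD) (use fin in \<open>auto intro!: has_sum_finiteI\<close>)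
  then have hs: "((\<lambda>x. 1 / real k * (\<Sum>y\<in>?N x. ?q y)) has_sum (1 / real k * (real k * infsum ?q ?V))) ?V"
    by (rule has_sum_cmult_right)
  have ms: "?m summable_on ?V"
    by (rule summable_on_comparison_test[OF has_sum_imp_summable[OF hs]]) (use le in auto)
  then show "markov_operator G f \<in> ell2 ?V" by (simp add: ell2_def)
  have "infsum ?m ?V \<le> 1 / real k * (real k * infsum ?q ?V)"
    by (rule has_sum_mono[OF has_sum_infsum[OF ms] hs]) (rule le)
  also have "\<dots> \<le> infsum ?q ?V"
    by (simp add: infsum_nonneg)
  finally show "ell2_norm ?V (markov_operator G f) \<le> ell2_norm ?V f"
    by (simp add: ell2_norm_def)
qed

lemma spectral_radius_bdd_above:
  assumes "regular_ugraph k G"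
  shows "bdd_above ((\<lambda>f. ell2_norm (verts G) (markov_operator G f) / ell2_norm (verts G) f) ` ell2 (verts G))"
proof (rule bdd_aboveI2)
  fix f assume f: "f \<in> ell2 (verts G)"
  have "0 \<le> ell2_norm (verts G) f" by (simp add: ell2_norm_def infsum_nonneg)
  then show "ell2_norm (verts G) (markov_operator G f) / ell2_norm (verts G) f \<le> 1"
    using markov_operator_bounded(2)[OF assms f] by (auto simp: divide_le_eq_1 less_le)
qed

end

theory Submission
  imports Defs
begin

text \<open>Any \<open>2g - 1\<close> of the \<open>2g\<close> generators generate a free subgroup freely. To see this when \<open>z\<close> is
  omitted, let \<open>y\<close> be its partner in the commutator. The relator says that \<open>z\<close> conjugates \<open>y\<close> to a word
  \<open>c\<close> in the other generators whose exponent sum in \<open>y\<close> is \<open>1\<close>. On the free group without \<open>z\<close>, both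
  \<open>y\<close> and \<open>c\<close> act by bijections that raise the exponent sum in \<open>y\<close> by one, so they are conjugate as
  permutations, and the free action extends to the surface group. The orbit map thus sends every edge
  labelled by a letter other than \<open>z\<close> to an edge of the \<open>(4g - 2)\<close>-regular tree. In the Schur test, weight
  the edges towards the root by \<open>\<surd>(4g - 3)\<close> and the others by the inverse; then average over \<open>z\<close>. The
  result is \<open>\<mu>\<^sub>g \<le> \<surd>(4g - 3) / (2g - 1)\<close>, which is below all the stated constants.\<close>

section \<open>A weighted Schur test\<close>

lemma cauchy_schwarz_weighted:
  fixes a p :: "'i \<Rightarrow> real"
  assumes p: "\<And>i. i \<in> I \<Longrightarrow> 0 < p i"
  shows "(\<Sum>i\<in>I. a i)\<^sup>2 \<le> (\<Sum>i\<in>I. p i) * (\<Sum>i\<in>I. (a i)\<^sup>2 / p i)"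
proof -
  have "(\<Sum>i\<in>I. a i) = (\<Sum>i\<in>I. sqrt (p i) * (a i / sqrt (p i)))"
    by (rule sum.cong) (use p in \<open>auto simp: less_imp_neq[symmetric] dest: p\<close>)
  also have "\<dots>\<^sup>2 \<le> (\<Sum>i\<in>I. (sqrt (p i))\<^sup>2) * (\<Sum>i\<in>I. (a i / sqrt (p i))\<^sup>2)"
    by (rule Cauchy_Schwarz_ineq_sum)
  also have "\<dots> = (\<Sum>i\<in>I. p i) * (\<Sum>i\<in>I. (a i)\<^sup>2 / p i)"
    by (intro arg_cong2[where f = "(*)"] sum.cong) (auto simp: power_divide less_imp_le[OF p])
  finally show ?thesis .
qed

lemma has_sum_sum:
  fixes f :: "'i \<Rightarrow> 'v \<Rightarrow> real"
  assumes "finite I" "\<And>i. i \<in> I \<Longrightarrow> (f i has_sum a i) V"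
  shows "((\<lambda>v. \<Sum>i\<in>I. f i v) has_sum (\<Sum>i\<in>I. a i)) V"
  using assms by (induction I rule: finite_induct) (auto intro: has_sum_add)

text \<open>Cauchy-Schwarz with the weights \<open>p\<close> costs a factor C at each vertex and
  leaves \<open>(cmod (f (\<sigma> i v)))^2 / p i v\<close>. By \<open>pq\<close> this is at most
  the same square times \<open>q i\<close> at the image point, so after summing over V and
  reindexing along the bijections the column sums of \<open>q\<close> cost the second factor
  C.\<close>

lemma schur_test_bijections:
  fixes \<sigma> :: "'i \<Rightarrow> 'v \<Rightarrow> 'v" and f :: "'v \<Rightarrow> complex" and p q :: "'i \<Rightarrow> 'v \<Rightarrow> real"
  assumes I: "finite I" and bij: "\<And>i. i \<in> I \<Longrightarrow> bij_betw (\<sigma> i) V V"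
    and p: "\<And>i v. i \<in> I \<Longrightarrow> v \<in> V \<Longrightarrow> 0 < p i v"
    and q: "\<And>i v. i \<in> I \<Longrightarrow> v \<in> V \<Longrightarrow> 0 \<le> q i v"
    and pq: "\<And>i v. i \<in> I \<Longrightarrow> v \<in> V \<Longrightarrow> 1 \<le> p i v * q i (\<sigma> i v)"
    and pC: "\<And>v. v \<in> V \<Longrightarrow> (\<Sum>i\<in>I. p i v) \<le> C"
    and qC: "\<And>v. v \<in> V \<Longrightarrow> (\<Sum>i\<in>I. q i v) \<le> C"
    and C: "0 \<le> C" and f: "f \<in> ell2 V"
  shows "ell2_norm V (\<lambda>v. \<Sum>i\<in>I. f (\<sigma> i v)) \<le> C * ell2_norm V f"
proof -
  let ?n = "\<lambda>v. (cmod (f v))\<^sup>2" and ?m = "\<lambda>v. (cmod (\<Sum>i\<in>I. f (\<sigma> i v)))\<^sup>2"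
  let ?r = "\<lambda>v. \<Sum>i\<in>I. q i (\<sigma> i v) * ?n (\<sigma> i v)"
  have fs: "?n summable_on V" using f by (simp add: ell2_def)
  \<comment> \<open>Nonnegativity turns the bound on the sum into a bound on each weight, which
    makes the weighted squares summable.\<close>
  have qle: "q i v \<le> C" if "i \<in> I" "v \<in> V" for i v
    using member_le_sum[of i I "\<lambda>i. q i v"] qC[OF that(2)] q that I by fastforce
  have pointwise: "?m v \<le> C * ?r v" if v: "v \<in> V" for v
  proof -
    have "?m v \<le> (\<Sum>i\<in>I. cmod (f (\<sigma> i v)))\<^sup>2"
      by (rule power_mono[OF norm_sum]) simp
    also have "\<dots> \<le> (\<Sum>i\<in>I. p i v) * (\<Sum>i\<in>I. ?n (\<sigma> i v) / p i v)"
      by (rule cauchy_schwarz_weighted) (use p v in auto)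
    also have "\<dots> \<le> C * ?r v"
    proof (rule mult_mono[OF pC[OF v] _ C])
      have "?n (\<sigma> i v) / p i v \<le> q i (\<sigma> i v) * ?n (\<sigma> i v)" if i: "i \<in> I" for i
        using mult_right_mono[OF pq[OF i v], of "?n (\<sigma> i v)"] p[OF i v]
        by (simp add: divide_simps mult_ac)
      then show "(\<Sum>i\<in>I. ?n (\<sigma> i v) / p i v) \<le> ?r v" by (rule sum_mono)
      show "0 \<le> (\<Sum>i\<in>I. ?n (\<sigma> i v) / p i v)"
        by (rule sum_nonneg) (use p v in \<open>auto simp: less_imp_le\<close>)
    qed
    finally show ?thesis .
  qed
  have qs: "(\<lambda>v. q i v * ?n v) summable_on V" if "i \<in> I" for i
    by (rule summable_on_comparison_test[OF summable_on_cmult_right[OF fs, of C]])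
      (use qle q that in \<open>auto intro: mult_right_mono\<close>)
  \<comment> \<open>Each \<sigma> i permutes V, so evaluating at \<open>\<sigma> i v\<close> instead
    of \<open>v\<close> does not change the total.\<close>
  have "((\<lambda>v. q i (\<sigma> i v) * ?n (\<sigma> i v)) has_sum (\<Sum>\<^sub>\<infinity>v\<in>V. q i v * ?n v)) V" if "i \<in> I" for i
    using has_sum_reindex_bij_betw[OF bij[OF that], of "\<lambda>v. q i v * ?n v"]
      has_sum_infsum[OF qs[OF that]] by simp
  then have r: "(?r has_sum (\<Sum>i\<in>I. \<Sum>\<^sub>\<infinity>v\<in>V. q i v * ?n v)) V"
    by (rule has_sum_sum[OF I])
  have "((\<lambda>v. \<Sum>i\<in>I. q i v * ?n v) has_sum (\<Sum>i\<in>I. \<Sum>\<^sub>\<infinity>v\<in>V. q i v * ?n v)) V"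
    by (rule has_sum_sum[OF I]) (rule has_sum_infsum[OF qs])
  then have rle: "(\<Sum>i\<in>I. \<Sum>\<^sub>\<infinity>v\<in>V. q i v * ?n v) \<le> C * infsum ?n V"
    by (rule has_sum_mono[OF _ has_sum_cmult_right[OF has_sum_infsum[OF fs]]])
      (use qC in \<open>auto simp: sum_distrib_right[symmetric] intro: mult_right_mono\<close>)
  have Cr: "((\<lambda>v. C * ?r v) has_sum (C * (\<Sum>i\<in>I. \<Sum>\<^sub>\<infinity>v\<in>V. q i v * ?n v))) V"
    using r by (rule has_sum_cmult_right)
  have ms: "?m summable_on V"
    by (rule summable_on_comparison_test[OF has_sum_imp_summable[OF Cr]]) (use pointwise in auto)
  have "infsum ?m V \<le> C * (\<Sum>i\<in>I. \<Sum>\<^sub>\<infinity>v\<in>V. q i v * ?n v)"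
    by (rule has_sum_mono[OF has_sum_infsum[OF ms] Cr]) (rule pointwise)
  also have "\<dots> \<le> C * (C * infsum ?n V)"
    by (rule mult_left_mono[OF rle C])
  finally have "sqrt (infsum ?m V) \<le> sqrt (C\<^sup>2 * infsum ?n V)"
    by (simp add: power2_eq_square mult_ac)
  then show ?thesis
    using C by (simp add: ell2_norm_def real_sqrt_mult)
qed

section \<open>Reduced words\<close>

definition letter_inv :: "'a \<times> bool \<Rightarrow> 'a \<times> bool" where
  "letter_inv s = (fst s, \<not> snd s)"

lemma letter_inv_simps [simp]:
  "letter_inv (letter_inv s) = s" "fst (letter_inv s) = fst s" "letter_inv s \<noteq> s"
  "s \<noteq> letter_inv s" "letter_inv s = letter_inv t \<longleftrightarrow> s = t" "letter_inv (x, b) = (x, \<not> b)"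
  by (auto simp: letter_inv_def prod_eq_iff)

lemma gword_inv_Cons: "gword_inv (s # w) = gword_inv w @ [letter_inv s]"
  by (simp add: gword_inv_def letter_inv_def split_beta)

lemma gword_inv_gword_inv [simp]: "gword_inv (gword_inv w) = w"
  by (simp add: gword_inv_def rev_map map_idI split_beta)

lemma set_gword_inv: "set (gword_inv w) = letter_inv ` set w"
  by (simp add: gword_inv_def letter_inv_def split_beta image_def)

definition reduced :: "'a gword \<Rightarrow> bool" where
  "reduced w \<longleftrightarrow> successively (\<lambda>s t. t \<noteq> letter_inv s) w"

text \<open>Reduced words are stored with their last letter first.\<close>

definition push :: "'a \<times> bool \<Rightarrow> 'a gword \<Rightarrow> 'a gword" where
  "push s w = (if w \<noteq> [] \<and> hd w = letter_inv s then tl w else s # w)"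

lemma reduced_push: "reduced w \<Longrightarrow> reduced (push s w)"
  by (cases w) (auto simp: reduced_def push_def successively_Cons)

text \<open>If \<open>push s\<close> cancels the head, reducedness says that the next letter is not
  \<open>s\<close>, so pushing the inverse restores the head instead of cancelling again.\<close>

lemma push_push_inv: "reduced w \<Longrightarrow> push (letter_inv s) (push s w) = w"
  by (cases w) (auto simp: reduced_def push_def successively_Cons)

lemma reduced_fold_push: "reduced w \<Longrightarrow> reduced (fold push u w)"
  by (induction u arbitrary: w) (auto simp: reduced_push)

lemma fold_push_gword_inv: "reduced w \<Longrightarrow> fold push (gword_inv u) (fold push u w) = w"
  by (induction u arbitrary: w) (auto simp: gword_inv_def[of "[]"] gword_inv_Cons reduced_push push_push_inv)

lemma fold_push_gword_inv': "reduced w \<Longrightarrow> fold push u (fold push (gword_inv u) w) = w"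
  using fold_push_gword_inv[of w "gword_inv u"] by simp

definition exponent :: "'a \<Rightarrow> 'a \<times> bool \<Rightarrow> int" where
  "exponent z s = (if fst s = z then if snd s then 1 else -1 else 0)"

definition height :: "'a \<Rightarrow> 'a gword \<Rightarrow> int" where
  "height z w = sum_list (map (exponent z) w)"

text \<open>Cancelling removes a letter whose exponent is opposite to that of \<open>s\<close>, so
  both branches of \<open>push\<close> change the height alike.\<close>

lemma height_push: "height z (push s w) = height z w + exponent z s"
  by (cases w) (auto simp: height_def push_def exponent_def letter_inv_def)

lemma height_fold_push: "height z (fold push u w) = height z w + sum_list (map (exponent z) u)"
  by (induction u arbitrary: w) (auto simp: height_push)

section \<open>Conjugating two bijections that raise the height by one\<close>

text \<open>The inverse \<open>S\<close> is passed separately because the maps in question are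
  invertible only on a set such as the reduced words.\<close>

definition int_funpow :: "('a \<Rightarrow> 'a) \<Rightarrow> ('a \<Rightarrow> 'a) \<Rightarrow> int \<Rightarrow> 'a \<Rightarrow> 'a" where
  "int_funpow T S n = (if 0 \<le> n then T ^^ nat n else S ^^ nat (- n))"

locale height_shift =
  fixes \<Omega> :: "'a set" and h :: "'a \<Rightarrow> int" and T S :: "'a \<Rightarrow> 'a"
  assumes T: "x \<in> \<Omega> \<Longrightarrow> T x \<in> \<Omega>" and S: "x \<in> \<Omega> \<Longrightarrow> S x \<in> \<Omega>"
    and ST: "x \<in> \<Omega> \<Longrightarrow> S (T x) = x" and TS: "x \<in> \<Omega> \<Longrightarrow> T (S x) = x"
    and hT: "x \<in> \<Omega> \<Longrightarrow> h (T x) = h x + 1"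
begin

abbreviation pw :: "int \<Rightarrow> 'a \<Rightarrow> 'a" where "pw \<equiv> int_funpow T S"

lemma funpow_closed: "x \<in> \<Omega> \<Longrightarrow> (T ^^ n) x \<in> \<Omega>" "x \<in> \<Omega> \<Longrightarrow> (S ^^ n) x \<in> \<Omega>"
  by (induction n) (auto simp: T S)

lemma pw_closed: "x \<in> \<Omega> \<Longrightarrow> pw n x \<in> \<Omega>"
  by (simp add: int_funpow_def funpow_closed)

lemma pw_0: "pw 0 x = x"
  by (simp add: int_funpow_def)

lemma pw_add1:
  assumes x: "x \<in> \<Omega>"
  shows "pw (n + 1) x = T (pw n x)" and "pw (n + 1) x = pw n (T x)"
proof -
  have "pw (n + 1) x = T (pw n x) \<and> pw (n + 1) x = pw n (T x)"
  proof (cases "0 \<le> n")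
    case True
    then have "nat (n + 1) = Suc (nat n)" by simp
    then show ?thesis using True by (simp add: int_funpow_def funpow_swap1)
  next
    case False
    define k where "k = nat (- n - 1)"
    have k: "nat (- n) = Suc k" "n = - int k - 1" using False by (auto simp: k_def)
    \<comment> \<open>For \<open>k = 0\<close> the exponent \<open>n + 1\<close> is zero and falls
      under the nonnegative branch of \<open>int_funpow\<close>.\<close>
    have "pw (n + 1) x = (S ^^ k) x" using k(2) by (cases "k = 0") (simp_all add: int_funpow_def)
    moreover have "pw n x = S ((S ^^ k) x)" "pw n (T x) = (S ^^ k) (S (T x))"
      using False by (simp_all add: int_funpow_def k(1) funpow_swap1)
    ultimately show ?thesis
      using x by (simp add: TS ST funpow_closed)
  qed
  then show "pw (n + 1) x = T (pw n x)" "pw (n + 1) x = pw n (T x)" by auto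
qed

lemma pw_diff1: "x \<in> \<Omega> \<Longrightarrow> pw (n - 1) x = S (pw n x)"
  using pw_add1(1)[of x "n - 1"] by (simp add: ST pw_closed)

lemma pw_pw: "x \<in> \<Omega> \<Longrightarrow> pw m (pw n x) = pw (m + n) x"
proof (induction m rule: int_induct[where k = 0])
  case (step1 i)
  then show ?case using pw_add1(1)[of x "i + n"] pw_add1(1)[of "pw n x" i]
    by (simp add: pw_closed ac_simps)
next
  case (step2 i)
  then show ?case using pw_diff1[of x "i + n"] pw_diff1[of "pw n x" i]
    by (simp add: pw_closed algebra_simps)
qed (simp add: pw_0)

lemma height_pw: "x \<in> \<Omega> \<Longrightarrow> h (pw n x) = h x + n"
proof (induction n rule: int_induct[where k = 0])
  case (step1 i)
  then show ?case by (simp add: pw_add1(1) hT pw_closed)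
next
  case (step2 i)
  then show ?case using hT[of "pw (i - 1) x"] pw_add1(1)[of x "i - 1"] by (simp add: pw_closed)
qed (simp add: pw_0)

end

text \<open>Each orbit of \<open>T\<close>, and likewise of \<open>T'\<close>, meets the level of
  height zero in exactly one point. \<beta> moves \<open>x\<close> along \<open>T'\<close> to that
  level and then along \<open>T\<close> back to height \<open>h x\<close>; \<beta>' exchanges the
  two roles. Replacing \<open>x\<close> by \<open>T' x\<close> keeps the point on the zero level and
  adds one power of \<open>T\<close>.\<close>

lemma height_shifts_conjugate:
  assumes "height_shift \<Omega> h T S" "height_shift \<Omega> h T' S'"
  obtains \<beta> \<beta>' where
    "\<And>x. x \<in> \<Omega> \<Longrightarrow> \<beta> x \<in> \<Omega>" "\<And>x. x \<in> \<Omega> \<Longrightarrow> \<beta>' x \<in> \<Omega>"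
    "\<And>x. x \<in> \<Omega> \<Longrightarrow> \<beta>' (\<beta> x) = x" "\<And>x. x \<in> \<Omega> \<Longrightarrow> \<beta> (\<beta>' x) = x"
    "\<And>x. x \<in> \<Omega> \<Longrightarrow> \<beta> (T' x) = T (\<beta> x)"
proof -
  interpret A: height_shift \<Omega> h T S by fact
  interpret B: height_shift \<Omega> h T' S' by fact
  let ?\<beta> = "\<lambda>x. A.pw (h x) (B.pw (- h x) x)" and ?\<beta>' = "\<lambda>x. B.pw (h x) (A.pw (- h x) x)"
  show thesis
  proof
    fix x assume x: "x \<in> \<Omega>"
    show "?\<beta> x \<in> \<Omega>" "?\<beta>' x \<in> \<Omega>" using x by (simp_all add: A.pw_closed B.pw_closed)
    show "?\<beta>' (?\<beta> x) = x" "?\<beta> (?\<beta>' x) = x"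
      using x by (simp_all add: A.pw_closed B.pw_closed A.height_pw B.height_pw A.pw_pw B.pw_pw A.pw_0 B.pw_0)
    have "B.pw (- 1 - h x) (T' x) = B.pw (- h x) x"
      using B.pw_add1(2)[OF x, of "- 1 - h x"] by simp
    then show "?\<beta> (T' x) = T (?\<beta> x)"
      using x A.pw_add1(1)[of "B.pw (- h x) x" "h x"] by (simp add: B.hT B.pw_closed algebra_simps)
  qed
qed

section \<open>All but one of the generators act freely\<close>

text \<open>Invertible letters on which the relators act trivially define an action of the presented
  group. It is a right action, as \<open>fold\<close> applies the first letter first, which fits the
  right multiplications of the Cayley graph.\<close>

lemma pres_rel_fold:
  assumes closed: "\<And>s \<omega>. \<omega> \<in> \<Omega> \<Longrightarrow> step s \<omega> \<in> \<Omega>"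
    and inverse: "\<And>s \<omega>. \<omega> \<in> \<Omega> \<Longrightarrow> step (letter_inv s) (step s \<omega>) = \<omega>"
    and relator: "\<And>r \<omega>. r \<in> R \<Longrightarrow> \<omega> \<in> \<Omega> \<Longrightarrow> fold step r \<omega> = \<omega>"
  shows "(u, v) \<in> pres_rel X R \<Longrightarrow> \<omega> \<in> \<Omega> \<Longrightarrow> fold step u \<omega> = fold step v \<omega>"
proof (induction arbitrary: \<omega> rule: pres_rel.induct)
  have c: "fold step u \<omega> \<in> \<Omega>" if "\<omega> \<in> \<Omega>" for u \<omega>
    using that by (induction u arbitrary: \<omega>) (auto simp: closed)
  {
    case (pres_cancel u v x b)
    then show ?case using inverse[OF c[OF pres_cancel(4), of u], of "(x, b)"] by simp
  next
    case (pres_relator u v r)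
    then show ?case by (simp add: relator c)
  }
qed simp_all

definition commutator_word :: "nat \<Rightarrow> surface_gen gword" where
  "commutator_word j = [(GenA j, True), (GenB j, True), (GenA j, False), (GenB j, False)]"

lemma surface_relator_split:
  assumes "j \<in> {1..g}"
  obtains U V where "surface_relator g = U @ commutator_word j @ V"
    "\<And>s. s \<in> set U \<union> set V \<Longrightarrow> fst s \<noteq> GenA j \<and> fst s \<noteq> GenB j"
proof
  have "[1..<Suc g] = [1..<j] @ j # [Suc j..<Suc g]"
    using assms upt_add_eq_append[of 1 j "Suc g - j"] by (simp add: upt_conv_Cons del: upt_Suc)
  then show "surface_relator g = concat (map commutator_word [1..<j]) @ commutator_word j
      @ concat (map commutator_word [Suc j..<Suc g])"
    by (simp add: surface_relator_def commutator_word_def[abs_def] del: upt_Suc)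
qed (auto simp: commutator_word_def)

text \<open>Letters other than \<open>z\<close> act by \<open>push\<close>; the relator then only
  demands that \<open>z\<close> act by a bijection conjugating two given permutations of the reduced
  words.\<close>

lemma reduced_word_action:
  assumes z: "z \<in> surface_gens g"
  obtains step where
    "\<And>s w. reduced w \<Longrightarrow> reduced (step s w)"
    "\<And>s w. reduced w \<Longrightarrow> step (letter_inv s) (step s w) = w"
    "\<And>s w. fst s \<noteq> z \<Longrightarrow> step s w = push s w"
    "\<And>w. reduced w \<Longrightarrow> fold step (surface_relator g) w = w"
proof -
  obtain j where j: "j \<in> {1..g}" "z = GenA j \<or> z = GenB j"
    using z by (auto simp: surface_gens_def)
  obtain U V where UV: "surface_relator g = U @ commutator_word j @ V"
    "\<And>s. s \<in> set U \<union> set V \<Longrightarrow> fst s \<noteq> GenA j \<and> fst s \<noteq> GenB j"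
    using surface_relator_split[OF j(1)] by metis
  define y where "y = (if z = GenA j then GenB j else GenA j)"
  \<comment> \<open>\<open>c\<close> is the relator solved for z y z^-1: from U z y z^-1 y^-1 V = 1
    if \<open>z = GenA j\<close>, and from U y z y^-1 z^-1 V = 1 otherwise.\<close>
  define c where "c = (if z = GenA j then gword_inv U @ gword_inv V else V @ U) @ [(y, True)]"
  have fstUV: "fst s \<noteq> z" "fst s \<noteq> y" if "s \<in> set U \<union> set V" for s
    using UV(2)[OF that] j(2) by (auto simp: y_def)
  have e0: "sum_list (map (exponent y) u) = 0" if "\<And>s. s \<in> set u \<Longrightarrow> fst s \<noteq> y" for u
    using that by (induction u) (auto simp: exponent_def)
  have "sum_list (map (exponent y) U) = 0" "sum_list (map (exponent y) V) = 0"
    "sum_list (map (exponent y) (gword_inv U)) = 0" "sum_list (map (exponent y) (gword_inv V)) = 0"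
    using fstUV(2) by (force intro: e0 simp: set_gword_inv)+
  \<comment> \<open>\<open>U\<close> and \<open>V\<close> avoid \<open>y\<close>, so only the final
    letter of \<open>c\<close> counts, and \<open>c\<close> raises the height by one just as
    \<open>y\<close> does.\<close>
  then have ec: "sum_list (map (exponent y) c) = 1"
    by (simp add: c_def exponent_def)
  let ?\<Omega> = "{w. reduced w}"
  have 1: "height_shift ?\<Omega> (height y) (push (y, True)) (push (y, False))"
    by unfold_locales
      (use push_push_inv[of _ "(y, True)"] push_push_inv[of _ "(y, False)"] in
        \<open>auto simp: reduced_push height_push exponent_def\<close>)
  have 2: "height_shift ?\<Omega> (height y) (fold push c) (fold push (gword_inv c))"
    by unfold_locales
      (auto simp: reduced_fold_push fold_push_gword_inv fold_push_gword_inv' height_fold_push ec)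
  \<comment> \<open>In a right action the last property reads c z = z y, with \<beta> as the action
    of \<open>z\<close>.\<close>
  obtain \<beta> \<beta>' where \<beta>: "\<And>w. reduced w \<Longrightarrow> reduced (\<beta> w)" "\<And>w. reduced w \<Longrightarrow> reduced (\<beta>' w)"
    "\<And>w. reduced w \<Longrightarrow> \<beta>' (\<beta> w) = w" "\<And>w. reduced w \<Longrightarrow> \<beta> (\<beta>' w) = w"
    "\<And>w. reduced w \<Longrightarrow> \<beta> (fold push c w) = push (y, True) (\<beta> w)"
    using height_shifts_conjugate[OF 1 2] unfolding mem_Collect_eq by metis
  define step where "step = (\<lambda>s w. if fst s = z then if snd s then \<beta> w else \<beta>' w else push s w)"
  have step_push: "step s w = push s w" if "fst s \<noteq> z" for s w
    using that by (simp add: step_def)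
  have step_z: "step (z, True) = \<beta>" "step (z, False) = \<beta>'"
    by (auto simp: step_def)
  have yz: "y \<noteq> z" using j(2) by (auto simp: y_def)
  have fold_UV: "fold step U = fold push U" "fold step V = fold push V"
    using fstUV(1) by (intro fold_cong refl ext step_push; blast)+
  have rel: "fold step (surface_relator g) w = w" if w: "reduced w" for w
  proof -
    \<comment> \<open>\<open>v\<close> is the word that \<open>V\<close> carries to
      \<open>w\<close>; it remains to see that the commutator carries the image of \<open>w\<close>
      under \<open>U\<close> to \<open>v\<close>.\<close>
    define v where "v = fold push (gword_inv V) w"
    have v: "reduced v" "fold push V v = w"
      using w by (simp_all add: v_def reduced_fold_push fold_push_gword_inv')
    have y_cancel: "push (y, False) (push (y, True) x) = x" if "reduced x" for x
      using push_push_inv[OF that, of "(y, True)"] by simp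
    show ?thesis
    proof (cases "z = GenA j")
      case True
      have y: "y = GenB j" using True by (simp add: y_def)
      \<comment> \<open>The first part of \<open>c\<close> undoes \<open>U\<close>, the second leads
        from \<open>w\<close> to \<open>v\<close>, and \<open>y\<close> is pushed last.\<close>
      have "fold push c (fold push U w) = push (y, True) v"
        using True w by (simp add: c_def v_def fold_push_gword_inv)
      then have "push (y, True) (\<beta> (fold push U w)) = \<beta> (push (y, True) v)"
        using \<beta>(5)[of "fold push U w"] w by (simp add: reduced_fold_push)
      then have "fold step (commutator_word j) (fold push U w) = v"
        using v(1) yz True
        by (simp add: commutator_word_def y step_z[unfolded True] step_push \<beta> reduced_push y_cancel[unfolded y])
      then show ?thesis using v by (simp add: UV(1) fold_UV)
    next
      case False
      then have zB: "z = GenB j" using j(2) by simp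
      have y: "y = GenA j" using False by (simp add: y_def)
      \<comment> \<open>Here \<open>c\<close> first leads from \<open>v\<close> back to
        \<open>w\<close> along \<open>V\<close>, then applies \<open>U\<close> and pushes
        \<open>y\<close>.\<close>
      have "fold push c v = push (y, True) (fold push U w)"
        using False v by (simp add: c_def)
      then have "\<beta> (push (y, True) (fold push U w)) = push (y, True) (\<beta> v)"
        using \<beta>(5)[OF v(1)] by simp
      then have "fold step (commutator_word j) (fold push U w) = v"
        using v(1) yz zB
        by (simp add: commutator_word_def y step_z[unfolded zB] step_push \<beta> y_cancel[unfolded y])
      then show ?thesis using v by (simp add: UV(1) fold_UV)
    qed
  qed
  show thesis
  proof (rule that[of step])
    show "reduced (step s w)" if "reduced w" for s w
      using that by (simp add: step_def \<beta> reduced_push)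
    show "step (letter_inv s) (step s w) = w" if "reduced w" for s w
      using that by (simp add: step_def \<beta> push_push_inv) (simp add: letter_inv_def \<beta>)
  qed (use step_push rel in auto)
qed

section \<open>Letters of the surface group and positions in the tree\<close>

definition surface_letter :: "nat \<Rightarrow> surface_gen \<times> bool \<Rightarrow> surface_gen gword set" where
  "surface_letter g s = pres_rel (surface_gens g) {surface_relator g} `` {[s]}"

lemma surface_letter_carrier: "fst s \<in> surface_gens g \<Longrightarrow> surface_letter g s \<in> carrier (surface_group g)"
  by (simp add: surface_letter_def surface_group_def presented_group_carrierI)

lemma surface_letter_inv:
  "fst s \<in> surface_gens g \<Longrightarrow> inv\<^bsub>surface_group g\<^esub> (surface_letter g s) = surface_letter g (letter_inv s)"
  by (simp add: surface_letter_def surface_group_def presented_group_inv gword_inv_def letter_inv_def split_beta)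

lemma surface_sym_gens_letters: "surface_sym_gens g = surface_letter g ` (surface_gens g \<times> UNIV)"
proof -
  have "inv\<^bsub>surface_group g\<^esub> (surface_letter g (x, True)) = surface_letter g (x, False)"
    if "x \<in> surface_gens g" for x
    using surface_letter_inv[of "(x, True)" g] that by simp
  moreover have "pres_gen (surface_gens g) {surface_relator g} x = surface_letter g (x, True)" for x
    by (simp add: pres_gen_def surface_letter_def)
  moreover have "(\<lambda>b. surface_letter g (x, b)) ` UNIV =
      {surface_letter g (x, True), surface_letter g (x, False)}" for x
    unfolding UNIV_bool by auto
  moreover have "surface_letter g ` (surface_gens g \<times> UNIV) =
      (\<Union>x\<in>surface_gens g. (\<lambda>b. surface_letter g (x, b)) ` UNIV)"
    by auto
  ultimately show ?thesis by (simp add: surface_sym_gens_def Let_def)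
qed

lemma finite_surface_gens: "finite (surface_gens g)"
  by (simp add: surface_gens_def)

lemma card_surface_gens: "card (surface_gens g) = 2 * g"
  unfolding surface_gens_def by (subst card_Un_disjoint) (auto simp: card_image inj_on_def)

text \<open>The image has \<open>4 * g\<close> elements, as many as there are letters.\<close>

lemma inj_on_surface_letter: "inj_on (surface_letter g) (surface_gens g \<times> UNIV)"
  by (rule eq_card_imp_inj_on)
    (use surface_sym_gens_card[of g] in
      \<open>simp_all add: surface_sym_gens_letters finite_surface_gens card_cartesian_product card_surface_gens\<close>)

text \<open>The position of a group element is the image of the empty word, the root of the tree,
  under the right action. Multiplying by one more letter on the right applies one more step.\<close>

lemma surface_position:
  assumes z: "z \<in> surface_gens g"
  obtains pos where
    "\<And>x. x \<in> carrier (surface_group g) \<Longrightarrow> reduced (pos x)"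
    "\<And>x s. x \<in> carrier (surface_group g) \<Longrightarrow> fst s \<in> surface_gens g - {z} \<Longrightarrow>
      pos (x \<otimes>\<^bsub>surface_group g\<^esub> surface_letter g s) = push s (pos x)"
proof -
  let ?X = "surface_gens g" and ?R = "{surface_relator g}"
  obtain step where step:
    "\<And>s w. reduced w \<Longrightarrow> reduced (step s w)"
    "\<And>s w. reduced w \<Longrightarrow> step (letter_inv s) (step s w) = w"
    "\<And>s w. fst s \<noteq> z \<Longrightarrow> step s w = push s w"
    "\<And>w. reduced w \<Longrightarrow> fold step (surface_relator g) w = w"
    using reduced_word_action[OF z] by metis
  \<comment> \<open>The chosen representative does not matter, by
    \<open>pres_rel_fold\<close>.\<close>
  define pos where "pos = (\<lambda>x. fold step (SOME u. u \<in> x) [])"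
  have red: "reduced (fold step u w)" if "reduced w" for u w
    using that by (induction u arbitrary: w) (auto simp: step(1))
  have pos: "pos (pres_rel ?X ?R `` {u}) = fold step u []" if u: "u \<in> gwords ?X" for u
  proof -
    have "u \<in> pres_rel ?X ?R `` {u}" using pres_refl[OF u, of ?R] by simp
    then have "(SOME v. v \<in> pres_rel ?X ?R `` {u}) \<in> pres_rel ?X ?R `` {u}" by (rule someI)
    then have "(u, SOME v. v \<in> pres_rel ?X ?R `` {u}) \<in> pres_rel ?X ?R" by simp
    then have "fold step u [] = fold step (SOME v. v \<in> pres_rel ?X ?R `` {u}) []"
      by (rule pres_rel_fold[where \<Omega> = "{w. reduced w}", rotated 3]) (use step in \<open>auto simp: reduced_def\<close>)
    then show ?thesis by (simp add: pos_def)
  qed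
  show thesis
  proof (rule that[of pos])
    fix x assume x: "x \<in> carrier (surface_group g)"
    then obtain u where u: "u \<in> gwords ?X" "x = pres_rel ?X ?R `` {u}"
      unfolding surface_group_def by (rule presented_group_carrierE)
    show "reduced (pos x)" using u red[of "[]" u] by (simp add: pos reduced_def[of "[]"])
    fix s :: "surface_gen \<times> bool" assume s: "fst s \<in> ?X - {z}"
    have "x \<otimes>\<^bsub>surface_group g\<^esub> surface_letter g s = pres_rel ?X ?R `` {u @ [s]}"
      using u s by (simp add: surface_group_def surface_letter_def presented_group_mult)
    then show "pos (x \<otimes>\<^bsub>surface_group g\<^esub> surface_letter g s) = push s (pos x)"
      using u s by (simp add: pos step(3))
  qed
qed

section \<open>Schur weights on the edges of a regular tree\<close>

definition edge_weight :: "real \<Rightarrow> 'a gword \<Rightarrow> 'a \<times> bool \<Rightarrow> real" where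
  "edge_weight q w s = (if w \<noteq> [] \<and> hd w = letter_inv s then q else 1 / q)"

text \<open>An edge leading towards the root leads away from it when traversed backwards, so the two
  weights are \<open>q\<close> and \<open>1 / q\<close>.\<close>

lemma edge_weight_reverse:
  "reduced w \<Longrightarrow> q \<noteq> 0 \<Longrightarrow> edge_weight q w s * edge_weight q (push s w) (letter_inv s) = 1"
  by (cases w) (auto simp: edge_weight_def push_def reduced_def successively_Cons)

text \<open>At most one of the q^2 + 1 letters leads towards the root, which gives at most q + q^2 /
  q.\<close>

lemma sum_edge_weight_le:
  assumes L: "finite L" "real (card L) = q\<^sup>2 + 1" and q: "1 \<le> q"
  shows "(\<Sum>s\<in>L. edge_weight q w s) \<le> 2 * q"
proof -
  have q': "1 / q \<le> q" using q mult_mono[of 1 q 1 q] by (simp add: divide_simps)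
  \<comment> \<open>For empty \<open>w\<close> the value of \<open>hd w\<close> is unspecified, but
    the extra term is nonnegative, so the bound still holds.\<close>
  have "edge_weight q w s \<le> 1 / q + (if s = letter_inv (hd w) then q - 1 / q else 0)" for s
    using q' by (auto simp: edge_weight_def)
  then have "(\<Sum>s\<in>L. edge_weight q w s) \<le>
      (\<Sum>s\<in>L. 1 / q + (if s = letter_inv (hd w) then q - 1 / q else 0))"
    by (rule sum_mono)
  also have "\<dots> \<le> real (card L) / q + (q - 1 / q)"
    using L(1) q' by (simp add: sum.distrib)
  also have "\<dots> = 2 * q"
    using q by (simp add: L(2) field_simps power2_eq_square)
  finally show ?thesis .
qed

section \<open>The spectral radius\<close>

text \<open>The Schur test is applied once to all pairs of an omitted generator \<open>z\<close> and
  a letter \<open>s\<close> not built on \<open>z\<close>. Its constant is 4gq, every letter occurs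
  2g - 1 times and the degree is 4g, so the quotient is q / (2g - 1).\<close>

lemma mu_le:
  assumes g: "1 \<le> g"
  shows "mu g \<le> sqrt (4 * real g - 3) / (2 * real g - 1)"
proof -
  let ?G = "surface_group g" and ?X = "surface_gens g"
  let ?V = "carrier ?G" and ?L = "\<lambda>z. (?X - {z}) \<times> (UNIV :: bool set)"
  interpret group ?G by (rule surface_group_group)
  \<comment> \<open>Omitting one generator leaves 4g - 2 letters, and this number has to be q^2 +
    1.\<close>
  define q where "q = sqrt (4 * real g - 3)"
  have q: "1 \<le> q" "q\<^sup>2 = 4 * real g - 3" using g by (simp_all add: q_def)
  have V: "verts (surface_cayley_graph g) = ?V"
    by (simp add: surface_cayley_graph_def cayley_graph_def)
  obtain pos where pos: "\<And>z x. z \<in> ?X \<Longrightarrow> x \<in> ?V \<Longrightarrow> reduced (pos z x)"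
    "\<And>z x s. z \<in> ?X \<Longrightarrow> x \<in> ?V \<Longrightarrow> fst s \<in> ?X - {z} \<Longrightarrow>
      pos z (x \<otimes>\<^bsub>?G\<^esub> surface_letter g s) = push s (pos z x)"
  proof -
    have "\<exists>p. (\<forall>x\<in>?V. reduced (p x)) \<and>
      (\<forall>x\<in>?V. \<forall>s. fst s \<in> ?X - {z} \<longrightarrow> p (x \<otimes>\<^bsub>?G\<^esub> surface_letter g s) = push s (p x))"
      if "z \<in> ?X" for z using surface_position[OF that] by metis
    then show thesis using that by metis
  qed
  define I where "I = (SIGMA z:?X. ?L z)"
  define p where "p = (\<lambda>(z, s) x. edge_weight q (pos z x) s)"
  \<comment> \<open>Evaluated at the far end of the edge labelled \<open>s\<close>, this is the
    weight of the same edge traversed backwards.\<close>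
  define p' where "p' = (\<lambda>(z, s) x. edge_weight q (pos z x) (letter_inv s))"
  define C where "C = 2 * real g * (2 * q)"
  have finL: "finite (?L z)" for z by (simp add: finite_surface_gens)
  have cardL: "real (card (?L z)) = q\<^sup>2 + 1" if "z \<in> ?X" for z
    using that g by (simp add: card_cartesian_product card_surface_gens finite_surface_gens q of_nat_diff)
  have sumI: "(\<Sum>i\<in>I. a i) = (\<Sum>z\<in>?X. \<Sum>s\<in>?L z. a (z, s))" for a :: "_ \<Rightarrow> 'b :: comm_monoid_add"
    unfolding I_def by (subst sum.Sigma) (auto simp: finite_surface_gens)
  have sum_p: "(\<Sum>i\<in>I. p i x) \<le> C" for x
  proof -
    have "(\<Sum>i\<in>I. p i x) \<le> (\<Sum>z\<in>?X. 2 * q)"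
      unfolding sumI p_def prod.case
      by (rule sum_mono) (rule sum_edge_weight_le[OF finL cardL q(1)])
    then show ?thesis by (simp add: card_surface_gens C_def)
  qed
  have sum_p': "(\<Sum>i\<in>I. p' i x) \<le> C" for x
  proof -
    \<comment> \<open>The letters that remain for each \<open>z\<close> are closed under
      inversion.\<close>
    have "(\<Sum>i\<in>I. p' i x) = (\<Sum>i\<in>I. p i x)"
      unfolding sumI p_def p'_def prod.case
      by (intro sum.cong refl sum.reindex_bij_witness[of _ letter_inv letter_inv])
        (auto simp: letter_inv_def)
    then show ?thesis using sum_p by simp
  qed
  have letterV: "surface_letter g s \<in> ?V" if "(z, s) \<in> I" for z s
    using that by (intro surface_letter_carrier) (auto simp: I_def)
  have bound: "ell2_norm ?V (\<lambda>x. \<Sum>i\<in>I. f (x \<otimes>\<^bsub>?G\<^esub> surface_letter g (snd i))) \<le> C * ell2_norm ?V f"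
    if f: "f \<in> ell2 ?V" for f
  proof (rule schur_test_bijections[where p = p and q = p', OF _ _ _ _ _ sum_p sum_p' _ f])
    show "finite I" by (simp add: I_def finite_surface_gens)
    show "0 \<le> C" using q(1) by (simp add: C_def)
  next
    fix i assume i: "i \<in> I"
    obtain z s where zs: "i = (z, s)" by (cases i)
    have s: "z \<in> ?X" "fst s \<in> ?X - {z}" "surface_letter g s \<in> ?V"
      using i letterV by (auto simp: I_def zs)
    show "bij_betw (\<lambda>x. x \<otimes>\<^bsub>?G\<^esub> surface_letter g (snd i)) ?V ?V"
      by (rule bij_betw_byWitness[where f' = "\<lambda>x. x \<otimes>\<^bsub>?G\<^esub> inv\<^bsub>?G\<^esub> (surface_letter g s)"])
        (use s in \<open>auto simp: zs m_assoc\<close>)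
    fix x assume x: "x \<in> ?V"
    show "0 < p i x" "0 \<le> p' i x" using q(1) by (simp_all add: zs p_def p'_def edge_weight_def)
    show "1 \<le> p i x * p' i (x \<otimes>\<^bsub>?G\<^esub> surface_letter g (snd i))"
      using q(1) edge_weight_reverse[OF pos(1)[OF s(1) x], of q s]
      by (simp add: zs p_def p'_def pos(2)[OF s(1) x s(2)])
  qed
  have markov: "markov_operator (surface_cayley_graph g) f x =
      (1 / (4 * of_nat g * (2 * of_nat g - 1))) * (\<Sum>i\<in>I. f (x \<otimes>\<^bsub>?G\<^esub> surface_letter g (snd i)))"
    if x: "x \<in> ?V" for f x
  proof -
    let ?f = "\<lambda>s. f (x \<otimes>\<^bsub>?G\<^esub> surface_letter g s)"
    have "inj_on (\<lambda>s. x \<otimes>\<^bsub>?G\<^esub> surface_letter g s) (?X \<times> UNIV)"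
    proof (rule inj_onI)
      fix s t assume st: "s \<in> ?X \<times> UNIV" "t \<in> ?X \<times> UNIV"
        "x \<otimes>\<^bsub>?G\<^esub> surface_letter g s = x \<otimes>\<^bsub>?G\<^esub> surface_letter g t"
      have "surface_letter g s = surface_letter g t"
        using st x surface_letter_carrier[of s g] surface_letter_carrier[of t g] by (simp add: mem_Times_iff)
      then show "s = t" using inj_on_surface_letter st by (auto dest: inj_onD)
    qed
    then have nb: "(\<Sum>y\<in>neighbors (surface_cayley_graph g) x. f y) = (\<Sum>s\<in>?X \<times> UNIV. ?f s)"
      unfolding surface_neighbors[OF x] surface_sym_gens_letters image_image
      by (simp add: sum.reindex)
    have card: "card (neighbors (surface_cayley_graph g) x) = 4 * g"
      using surface_cayley_graph_regular x by (simp add: regular_ugraph_def V)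
    \<comment> \<open>A letter is counted once for each omitted generator different from its own,
      hence 2g - 1 times.\<close>
    have "(\<Sum>i\<in>I. ?f (snd i)) = (\<Sum>z\<in>?X. \<Sum>y\<in>?X - {z}. \<Sum>b\<in>UNIV. ?f (y, b))"
      unfolding sumI by (simp add: sum.cartesian_product)
    also have "\<dots> = (\<Sum>z\<in>?X. (\<Sum>y\<in>?X. \<Sum>b\<in>UNIV. ?f (y, b)) - (\<Sum>b\<in>UNIV. ?f (z, b)))"
      by (rule sum.cong) (simp_all add: sum_diff1 finite_surface_gens)
    also have "\<dots> = (2 * of_nat g - 1) * (\<Sum>y\<in>?X. \<Sum>b\<in>UNIV. ?f (y, b))"
      by (simp add: sum_subtractf card_surface_gens algebra_simps)
    also have "(\<Sum>y\<in>?X. \<Sum>b\<in>UNIV. ?f (y, b)) = (\<Sum>s\<in>?X \<times> UNIV. ?f s)"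
      by (simp add: sum.cartesian_product)
    finally have sumf: "(\<Sum>i\<in>I. ?f (snd i)) = (2 * of_nat g - 1) * (\<Sum>s\<in>?X \<times> UNIV. ?f s)" .
    have "(2 * of_nat g - 1 :: complex) = of_nat (2 * g - 1)" using g by (simp add: of_nat_diff)
    then have "(2 * of_nat g - 1 :: complex) \<noteq> 0" using g by (simp only: of_nat_eq_0_iff)
    then show ?thesis
      unfolding markov_operator_def nb card sumf by simp
  qed
  have ratio: "ell2_norm ?V (markov_operator (surface_cayley_graph g) f) / ell2_norm ?V f
      \<le> q / (2 * real g - 1)"
    if f: "f \<in> ell2 ?V" for f
  proof -
    let ?k = "4 * real g * (2 * real g - 1)"
    let ?F = "\<lambda>x. \<Sum>i\<in>I. f (x \<otimes>\<^bsub>?G\<^esub> surface_letter g (snd i))"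
    have k: "0 < ?k" using g by simp
    have "(1 / (4 * of_nat g * (2 * of_nat g - 1)) :: complex) = of_real (1 / ?k)" by simp
    then have ck: "cmod (1 / (4 * of_nat g * (2 * of_nat g - 1))) = 1 / ?k"
      using k by (simp only: norm_of_real abs_of_pos zero_less_divide_1_iff)
    have "(cmod (markov_operator (surface_cayley_graph g) f x))\<^sup>2 =
        (1 / ?k)\<^sup>2 * (cmod (?F x))\<^sup>2" if "x \<in> ?V" for x
      by (simp only: markov[OF that] norm_mult[of "1 / _"] ck power_mult_distrib)
    then have "ell2_norm ?V (markov_operator (surface_cayley_graph g) f) =
        sqrt ((1 / ?k)\<^sup>2 * (\<Sum>\<^sub>\<infinity>x\<in>?V. (cmod (?F x))\<^sup>2))"
      unfolding ell2_norm_def by (simp cong: infsum_cong add: infsum_cmult_right')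
    also have "\<dots> = 1 / ?k * ell2_norm ?V ?F"
      using k by (simp add: ell2_norm_def real_sqrt_mult)
    also have "\<dots> \<le> 1 / ?k * (C * ell2_norm ?V f)"
      by (rule mult_left_mono[OF bound[OF f]]) (use k in simp)
    also have "\<dots> = q / (2 * real g - 1) * ell2_norm ?V f"
      using g by (simp add: C_def)
    finally have le: "ell2_norm ?V (markov_operator (surface_cayley_graph g) f) \<le>
        q / (2 * real g - 1) * ell2_norm ?V f" .
    have "0 \<le> q / (2 * real g - 1)" using g q(1) by simp
    moreover have "0 \<le> ell2_norm ?V f" by (simp add: ell2_norm_def infsum_nonneg)
    \<comment> \<open>If the norm of \<open>f\<close> is zero, the quotient is zero by the
      convention for division.\<close>
    ultimately show ?thesis
      using le by (cases "ell2_norm ?V f = 0") (auto simp: pos_divide_le_eq less_le)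
  qed
  \<comment> \<open>The supremum is over a nonempty set, as \<open>cSUP_least\<close>
    requires.\<close>
  have "(\<lambda>_. 0) \<in> ell2 ?V" by (simp add: ell2_def)
  then have "mu g \<le> q / (2 * real g - 1)"
    unfolding mu_def spectral_radius_def ell2_onorm_def V by (intro cSUP_least ratio) auto
  then show ?thesis by (simp add: q_def)
qed

text \<open>Squaring removes the root, so that each numerical bound becomes an inequality between
  rational numbers.\<close>

lemma mu_le_of_square:
  assumes "1 \<le> g" "0 \<le> c" "4 * real g - 3 \<le> (c * (2 * real g - 1))\<^sup>2"
  shows "mu g \<le> c"
proof -
  have "sqrt (4 * real g - 3) \<le> c * (2 * real g - 1)"
    using assms by (intro real_le_lsqrt) auto
  then have "sqrt (4 * real g - 3) / (2 * real g - 1) \<le> c"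
    using assms(1) by (simp add: pos_divide_le_eq)
  then show ?thesis using mu_le[OF assms(1)] by simp
qed

theorem corollary2:
  shows "mu 2 \<le> 0.784 \<and>
    mu 2 \<le> 0.7675 \<and> mu 3 \<le> 0.6588 \<and> mu 4 \<le> 0.5872 \<and> mu 5 \<le> 0.5352 \<and> mu 6 \<le> 0.4953 \<and>
    mu 7 \<le> 0.4633 \<and> mu 8 \<le> 0.4369 \<and> mu 9 \<le> 0.4147 \<and> mu 10 \<le> 0.3956"
  by (intro conjI mu_le_of_square) (simp_all add: power2_eq_square)

end
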